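(* Let $T$ be a finite tree with at least $3$ vertices, and for each integer $N\ge 1$ let $M_N$ be the spherical maximal operator on the Cartesian power $T^N$. Then for every $1\le p<\infty$ and every $N\ge 1$, $$\|M_N\|_p^p \;\ge\; \left(\frac{|T|}{|\mathrm{Leaf}(T)|}\right)^N .$$ In particular, the norm grows exponentially in the dimension: for every $1\le p<\infty$ there is a constant $c>1$ (depending on $T$ and $p$) such that $\|M_N\|_p\ge c^N$ for all $N\ge 1$.
   Context: All graphs are simple, connected, undirected, unweighted and finite (with nonempty vertex set). For a graph $G$, $V(G)$ is the vertex set, $|G|=|V(G)|$, and $d_G$ is the shortest-path distance. The Cartesian product $G\,\square\,H$ has vertex set $V(G)\times V(H)$, with $(g,h)$ adjacent to $(g',h')$ iff either $g=g'$ and $h$ is adjacent to $h'$ in $H$, or $h=h'$ and $g$ is adjacent to $g'$ in $G$. The Cartesian power is $G^1=G$, $G^N=G^{N-1}\,\square\,G$ for $N>1$; thus $V(G^N)=V(G)^N$, and $x,y$ are adjacent iff they differ in exactly one coordinate $k$ and $x_k,y_k$ are adjacent in $G$. For $x\in V(G)$ and an integer $r\ge 0$, the sphere is $\mathbb{S}^G_r(x)=\{y\in V(G): d_G(x,y)=r\}$. The spherical maximal operator $M^G$ is defined for $f:V(G)\to\mathbb{C}$ by $$M^Gf(x)=\sup_{r\ge 0,\ \mathbb{S}^G_r(x)\ne\emptyset}\frac{1}{|\mathbb{S}^G_r(x)|}\left|\sum_{y\in \mathbb{S}^G_r(x)}f(y)\right|.$$ $L^p$ norms on $V(G)$ are with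 respect to counting measure, and $\|M^G\|_p=\sup_{\|f\|_p=1}\|M^Gf\|_p$. Here $M_N=M^{T^N}$. $\mathrm{Leaf}(T)=\{t\in V(T):\deg(t)=1\}$. *)

theory Defs
  imports Complex_Main "HOL-Library.FuncSet" "Graph_Theory.Graph_Theory"
begin

text \<open>
  A finite simple graph is a \<^locale>\<open>pair_graph\<close>: every undirected edge is
  represented by its two opposite arcs.
\<close>

text \<open>
  The constant \<^const>\<open>Digraph_Component.tree\<close> is not usable for this representation,
  because its acyclicity condition also excludes the closed walk of length 2 given by
  an arc and its reverse. In a simple graph the (undirected) cycles are exactly the
  cycles of length at least 3.
\<close>
definition simple_tree :: "'a pair_pre_digraph \<Rightarrow> bool" where
  "simple_tree G \<longleftrightarrow> pair_graph G \<and> Digraph_Component.connected (with_proj G) \<and>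
     \<not> (\<exists>p. pre_digraph.cycle (with_proj G) p \<and> 3 \<le> length p)"

definition leaves :: "'a pair_pre_digraph \<Rightarrow> 'a set" where
  "leaves G = {t \<in> pverts G. out_degree (with_proj G) t = 1}"

definition cart_prod ::
  "'a pair_pre_digraph \<Rightarrow> 'b pair_pre_digraph \<Rightarrow> ('a \<times> 'b) pair_pre_digraph" where
  "cart_prod G H = \<lparr> pverts = pverts G \<times> pverts H,
     parcs = {((g, h), (g', h')). g \<in> pverts G \<and> g' \<in> pverts G \<and> h \<in> pverts H \<and> h' \<in> pverts H \<and>
        (g = g' \<and> (h, h') \<in> parcs H \<or> h = h' \<and> (g, g') \<in> parcs G)} \<rparr>"

text \<open>
  The vertices of the \<open>N\<close>-th Cartesian power are the \<open>N\<close>-tuples of vertices,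
  encoded as extensional functions on \<open>{..<N}\<close>. The recursion
  \<open>G^1 = G\<close>, \<open>G^(N+1) = G^N \<box> G\<close> holds up to isomorphism, see
  \<open>cart_pow_1_iso\<close> and \<open>cart_pow_Suc_iso\<close> below.
\<close>
definition cart_pow :: "'a pair_pre_digraph \<Rightarrow> nat \<Rightarrow> (nat \<Rightarrow> 'a) pair_pre_digraph" where
  "cart_pow G N = \<lparr> pverts = {..<N} \<rightarrow>\<^sub>E pverts G,
     parcs = {(x, y). x \<in> {..<N} \<rightarrow>\<^sub>E pverts G \<and> y \<in> {..<N} \<rightarrow>\<^sub>E pverts G \<and>
        (\<exists>k<N. (x k, y k) \<in> parcs G \<and> (\<forall>j<N. j \<noteq> k \<longrightarrow> x j = y j))} \<rparr>"

text \<open>\<open>wf_digraph.\<mu>\<close> is the infimum of the costs of all walks; unit costs give the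
  shortest-path distance.\<close>
definition graph_dist :: "'a pair_pre_digraph \<Rightarrow> 'a \<Rightarrow> 'a \<Rightarrow> ereal" where
  "graph_dist G x y = wf_digraph.\<mu> (with_proj G) (\<lambda>_. 1) x y"

definition graph_sphere :: "'a pair_pre_digraph \<Rightarrow> nat \<Rightarrow> 'a \<Rightarrow> 'a set" where
  "graph_sphere G r x = {y \<in> pverts G. graph_dist G x y = ereal (real r)}"

definition spherical_maximal :: "'a pair_pre_digraph \<Rightarrow> ('a \<Rightarrow> complex) \<Rightarrow> 'a \<Rightarrow> real" where
  "spherical_maximal G f x =
     (SUP r \<in> {r. graph_sphere G r x \<noteq> {}}.
        1 / real (card (graph_sphere G r x)) * cmod (\<Sum>y\<in>graph_sphere G r x. f y))"

definition lp_norm :: "'a set \<Rightarrow> real \<Rightarrow> ('a \<Rightarrow> 'b::real_normed_vector) \<Rightarrow> real" where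
  "lp_norm V p f = (\<Sum>x\<in>V. norm (f x) powr p) powr (1 / p)"

text \<open>For a finite graph this supremum and the one above are over nonempty bounded sets of reals.\<close>
definition maximal_op_norm :: "'a pair_pre_digraph \<Rightarrow> real \<Rightarrow> real" where
  "maximal_op_norm G p =
     (SUP f \<in> {f. lp_norm (pverts G) p f = 1}. lp_norm (pverts G) p (spherical_maximal G f))"

lemma pair_graph_cart_pow:
  assumes "pair_graph G"
  shows "pair_graph (cart_pow G N)"
proof -
  interpret pair_graph G by fact
  have sym: "(b, a) \<in> parcs G" if "(a, b) \<in> parcs G" for a b
    using that pair_sym_arcs by (auto simp: symmetric_def dest: symD)
  have fin: "finite (pverts (cart_pow G N))"
    by (simp add: cart_pow_def finite_PiE)
  have sub: "parcs (cart_pow G N) \<subseteq> pverts (cart_pow G N) \<times> pverts (cart_pow G N)"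
    by (auto simp: cart_pow_def)
  show ?thesis
  proof
    fix e assume "e \<in> parcs (cart_pow G N)"
    then show "fst e \<in> pverts (cart_pow G N)" "snd e \<in> pverts (cart_pow G N)"
      using sub by auto
  next
    show "finite (pverts (cart_pow G N))" by (rule fin)
    show "finite (parcs (cart_pow G N))"
      using sub fin by (meson finite_SigmaI finite_subset)
  next
    fix e assume "e \<in> parcs (cart_pow G N)"
    then show "fst e \<noteq> snd e"
      using no_loops by (force simp: cart_pow_def)
  next
    show "symmetric (with_proj (cart_pow G N))"
      unfolding symmetric_def with_proj_simps
    proof (rule symI)
      fix x y assume "(x, y) \<in> parcs (cart_pow G N)"
      then show "(y, x) \<in> parcs (cart_pow G N)"
        using sym by (auto simp: cart_pow_def)
    qed
  qed
qed

lemma cart_pow_1_iso: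
  shows "bij_betw (\<lambda>x. x 0) (pverts (cart_pow G 1)) (pverts G)"
    and "x \<in> pverts (cart_pow G 1) \<Longrightarrow> y \<in> pverts (cart_pow G 1) \<Longrightarrow>
      (x, y) \<in> parcs (cart_pow G 1) \<longleftrightarrow> (x 0, y 0) \<in> parcs G"
proof -
  show "bij_betw (\<lambda>x. x 0) (pverts (cart_pow G 1)) (pverts G)"
    by (rule bij_betwI[where g = "\<lambda>a. \<lambda>i\<in>{..<1}. a"])
       (auto simp: cart_pow_def PiE_def extensional_def fun_eq_iff)
qed (auto simp: cart_pow_def)

lemma cart_pow_Suc_iso:
  shows "bij_betw (\<lambda>(x, a). x(N := a))
           (pverts (cart_prod (cart_pow G N) G)) (pverts (cart_pow G (Suc N)))"
    and "(x, a) \<in> pverts (cart_prod (cart_pow G N) G) \<Longrightarrow>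
      (y, b) \<in> pverts (cart_prod (cart_pow G N) G) \<Longrightarrow>
      (x(N := a), y(N := b)) \<in> parcs (cart_pow G (Suc N)) \<longleftrightarrow>
      ((x, a), (y, b)) \<in> parcs (cart_prod (cart_pow G N) G)"
proof -
  show "bij_betw (\<lambda>(x, a). x(N := a))
           (pverts (cart_prod (cart_pow G N) G)) (pverts (cart_pow G (Suc N)))"
    by (rule bij_betwI[where g = "\<lambda>x. (x(N := undefined), x N)"])
       (auto simp: cart_pow_def cart_prod_def PiE_def Pi_def extensional_def fun_eq_iff less_Suc_eq)
next
  assume xa: "(x, a) \<in> pverts (cart_prod (cart_pow G N) G)"
    and yb: "(y, b) \<in> pverts (cart_prod (cart_pow G N) G)"
  have x: "x \<in> {..<N} \<rightarrow>\<^sub>E pverts G" "a \<in> pverts G" and y: "y \<in> {..<N} \<rightarrow>\<^sub>E pverts G" "b \<in> pverts G"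
    using xa yb by (auto simp: cart_prod_def cart_pow_def)
  have mem: "x(N := a) \<in> {..<Suc N} \<rightarrow>\<^sub>E pverts G" "y(N := b) \<in> {..<Suc N} \<rightarrow>\<^sub>E pverts G"
    using x y by (auto simp: PiE_def Pi_def extensional_def less_Suc_eq)
  have eq: "(\<forall>j<N. x j = y j) \<longleftrightarrow> x = y"
    using x y by (auto intro: PiE_ext)
  have "(x(N := a), y(N := b)) \<in> parcs (cart_pow G (Suc N)) \<longleftrightarrow>
      (a, b) \<in> parcs G \<and> (\<forall>j<N. x j = y j) \<or>
      a = b \<and> (\<exists>k<N. (x k, y k) \<in> parcs G \<and> (\<forall>j<N. j \<noteq> k \<longrightarrow> x j = y j))"
    using mem unfolding cart_pow_def by (auto simp: less_Suc_eq)
  then show "(x(N := a), y(N := b)) \<in> parcs (cart_pow G (Suc N)) \<longleftrightarrow>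
      ((x, a), (y, b)) \<in> parcs (cart_prod (cart_pow G N) G)"
    using x y eq by (auto simp: cart_prod_def cart_pow_def)
qed

end

theory Submission
  imports Defs
begin

text \<open>
  The distance in \<open>T^N\<close> is the sum of the coordinatewise distances, so the sphere of largest
  radius around \<open>x\<close> is the product of the spheres of largest radius around the coordinates
  \<open>x k\<close>. In a tree with at least two vertices, a vertex at maximal distance from a given one is a
  leaf: otherwise it has two neighbours, and these are joined by a path avoiding it, which closes
  up to a cycle. Hence the indicator function \<open>f\<close> of \<open>Leaf(T)^N\<close> has average \<open>1\<close> over some sphere
  around every vertex, so \<open>M f \<ge> 1\<close> everywhere while \<open>\<parallel>f\<parallel>\<^sub>p^p = \<bar>Leaf(T)\<bar>^N\<close>.
\<close>

section \<open>Distance functions\<close>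

text \<open>A local characterisation of the distance from \<open>x\<close>. It passes to Cartesian powers without
  any manipulation of walks.\<close>
definition is_dist_from :: "'a pair_pre_digraph \<Rightarrow> 'a \<Rightarrow> ('a \<Rightarrow> nat) \<Rightarrow> bool" where
  "is_dist_from G x h \<longleftrightarrow> h x = 0 \<and> (\<forall>u v. (u, v) \<in> parcs G \<longrightarrow> h v \<le> h u + 1) \<and>
     (\<forall>v \<in> pverts G. v \<noteq> x \<longrightarrow> (\<exists>u. (u, v) \<in> parcs G \<and> h v = h u + 1))"

text \<open>The one-step inequality telescopes along the walk. For walks from \<open>x\<close>,
  where \<open>h\<close> vanishes, this bounds the length below by \<open>h v\<close>.\<close>

lemma is_dist_from_walk_bound:
  assumes "pair_wf_digraph G" "is_dist_from G x h" "pre_digraph.awalk (with_proj G) u p v"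
  shows "h v \<le> h u + length p"
proof -
  interpret pair_wf_digraph G by fact
  show ?thesis using assms(3)
  proof (induction p arbitrary: u)
    case Nil
    then show ?case by (simp add: awalk_Nil_iff)
  next
    case (Cons e p)
    then have e: "e \<in> parcs G" "u = fst e" and IH: "h v \<le> h (snd e) + length p"
      by (auto simp: awalk_Cons_iff)
    have "h (snd e) \<le> h u + 1"
      using assms(2) e unfolding is_dist_from_def by (metis prod.collapse)
    with IH show ?case by simp
  qed
qed

text \<open>Stepping back through predecessors lowers \<open>h\<close> by exactly one each time and
  can only stop at \<open>x\<close>, so the bound of the previous lemma is attained.\<close>

lemma is_dist_from_walk_exists:
  assumes "pair_wf_digraph G" "is_dist_from G x h" "x \<in> pverts G" "v \<in> pverts G"
  shows "\<exists>p. pre_digraph.awalk (with_proj G) x p v \<and> length p = h v"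
proof -
  interpret pair_wf_digraph G by fact
  show ?thesis using assms(4)
  proof (induction "h v" arbitrary: v rule: less_induct)
    case less
    show ?case
    proof (cases "v = x")
      case True
      then show ?thesis
        using assms(2,3) by (intro exI[of _ "[]"]) (auto simp: awalk_Nil_iff is_dist_from_def)
    next
      case False
      then obtain u where u: "(u, v) \<in> parcs G" "h v = h u + 1"
        using assms(2) less.prems unfolding is_dist_from_def by blast
      then obtain p where "awalk x p u" "length p = h u"
        using less.hyps[of u] wellformed' by auto
      moreover have "awalk u [(u, v)] v"
        using arc_implies_awalk[OF u(1)] by simp
      ultimately show ?thesis
        using u by (intro exI[of _ "p @ [(u, v)]"]) (auto intro: awalk_appendI simp del: awalk_append_iff)
    qed
  qed
qed

lemma (in wf_digraph) awalk_cost_unit: "awalk_cost (\<lambda>_. 1) p = real (length p)"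
  by (induction p) auto

lemma graph_dist_eq:
  assumes "pair_wf_digraph G" "is_dist_from G x h" "x \<in> pverts G" "v \<in> pverts G"
  shows "graph_dist G x v = ereal (real (h v))"
proof -
  interpret pair_wf_digraph G by fact
  have h0: "h x = 0" using assms(2) by (simp add: is_dist_from_def)
  obtain p where p: "awalk x p v" "length p = h v"
    using is_dist_from_walk_exists[OF assms] by auto
  show ?thesis unfolding graph_dist_def \<mu>_def
  proof (rule INF_eqI)
    fix q assume "q \<in> {p. awalk x p v}"
    then show "ereal (real (h v)) \<le> ereal (awalk_cost (\<lambda>_. 1) q)"
      using is_dist_from_walk_bound[OF assms(1,2), of x q v] h0 by (simp add: awalk_cost_unit)
  next
    fix y assume "\<And>q. q \<in> {p. awalk x p v} \<Longrightarrow> y \<le> ereal (awalk_cost (\<lambda>_. 1) q)"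
    from this[of p] show "y \<le> ereal (real (h v))"
      using p by (simp add: awalk_cost_unit)
  qed
qed

lemma graph_sphere_eq:
  assumes "pair_wf_digraph G" "is_dist_from G x h" "x \<in> pverts G"
  shows "graph_sphere G r x = {y \<in> pverts G. h y = r}"
  using graph_dist_eq[OF assms] by (auto simp: graph_sphere_def)

text \<open>The empty walk costs 0 and no walk costs less. This makes the index set of radii in
  \<open>spherical_maximal\<close> nonempty.\<close>

lemma self_in_graph_sphere_0:
  assumes "pair_wf_digraph G" "x \<in> pverts G"
  shows "x \<in> graph_sphere G 0 x"
proof -
  interpret pair_wf_digraph G by fact
  have "\<mu> (\<lambda>_. 1) x x = 0" unfolding \<mu>_def
  proof (rule INF_eqI)
    fix q assume "q \<in> {p. awalk x p x}"
    then show "0 \<le> ereal (awalk_cost (\<lambda>_. 1) q)" by (simp add: awalk_cost_unit)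
  next
    fix y assume "\<And>q. q \<in> {p. awalk x p x} \<Longrightarrow> y \<le> ereal (awalk_cost (\<lambda>_. 1) q)"
    from this[of "[]"] show "y \<le> 0"
      using assms(2) by (simp add: awalk_Nil_iff zero_ereal_def)
  qed
  then show ?thesis using assms(2) by (simp add: graph_sphere_def graph_dist_def)
qed

section \<open>Existence of distance functions, and their sums on Cartesian powers\<close>

lemma connected_is_dist_from_exists:
  assumes "pair_graph G" "Digraph_Component.connected (with_proj G)" "x \<in> pverts G"
  shows "\<exists>h. is_dist_from G x h"
proof -
  interpret pair_graph G by fact
  have reach: "\<exists>n. (x, v) \<in> parcs G ^^ n" if "v \<in> pverts G" for v
  proof -
    have "strongly_connected (with_proj G)"
      using assms(2) sym_arcs by (intro symmetric_connected_imp_strongly_connected)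
    then have "x \<rightarrow>\<^sup>*\<^bsub>with_proj G\<^esub> v"
      using assms(3) that by (auto simp: strongly_connected_def)
    then have "(x, v) \<in> (parcs G)\<^sup>*"
      by (auto simp: reachable_def dest: rtrancl_on_rtranclI)
    then show ?thesis by (simp add: rtrancl_power)
  qed
  \<comment> \<open>The least length of a walk from \<open>x\<close> to \<open>v\<close>, with walks
    encoded by relational powers of the arc set; \<open>reach\<close> provides one for every
    vertex.\<close>
  define h where "h = (\<lambda>v. LEAST n. (x, v) \<in> parcs G ^^ n)"
  have le: "h v \<le> n" if "(x, v) \<in> parcs G ^^ n" for v n
    unfolding h_def using that by (rule Least_le)
  have walk: "(x, v) \<in> parcs G ^^ h v" if "v \<in> pverts G" for v
    unfolding h_def using reach[OF that] by (rule LeastI_ex)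
  have arc: "h v \<le> h u + 1" if "(u, v) \<in> parcs G" for u v
    using le[of v "Suc (h u)"] walk[of u] that wellformed' by auto
  have "\<exists>u. (u, v) \<in> parcs G \<and> h v = h u + 1" if v: "v \<in> pverts G" "v \<noteq> x" for v
  proof -
    have "h v \<noteq> 0" using walk[OF v(1)] v(2) by (metis relpow_0_E)
    then obtain n where n: "h v = Suc n" by (cases "h v") auto
    then obtain u where u: "(x, u) \<in> parcs G ^^ n" "(u, v) \<in> parcs G"
      using walk[OF v(1)] by auto
    \<comment> \<open>Minimality gives \<open>h u \<le> n\<close>, and the arc inequality gives
      \<open>Suc n \<le> h u + 1\<close>.\<close>
    then have "h v = h u + 1" using le[OF u(1)] arc[OF u(2)] n by simp
    then show ?thesis using u by auto
  qed
  moreover have "h x = 0" using le[of x 0] by simp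
  ultimately have "is_dist_from G x h" using arc by (auto simp: is_dist_from_def)
  then show ?thesis by blast
qed

text \<open>An arc of the power moves one coordinate along an arc of \<open>G\<close>, so only one
  summand changes. A predecessor of \<open>v\<close> arises by stepping back in a coordinate where
  \<open>v\<close> and \<open>x\<close> differ.\<close>

lemma is_dist_from_cart_pow:
  assumes "pair_wf_digraph G" "x \<in> pverts (cart_pow G N)"
    and h: "\<And>k. k < N \<Longrightarrow> is_dist_from G (x k) (h k)"
  shows "is_dist_from (cart_pow G N) x (\<lambda>y. \<Sum>k<N. h k (y k))"
  unfolding is_dist_from_def
proof (intro conjI allI ballI impI)
  interpret pair_wf_digraph G by fact
  have split: "(\<Sum>j<N. h j (y j)) = h k (y k) + (\<Sum>j\<in>{..<N} - {k}. h j (y j))" if "k < N" for k y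
    using that by (intro sum.remove) auto
  have rest: "(\<Sum>j\<in>{..<N} - {k}. h j (u j)) = (\<Sum>j\<in>{..<N} - {k}. h j (v j))"
    if "\<forall>j<N. j \<noteq> k \<longrightarrow> u j = v j" for k u v
    using that by (intro sum.cong) auto
  show "(\<Sum>k<N. h k (x k)) = 0"
    using h by (simp add: is_dist_from_def)
  show "(\<Sum>k<N. h k (v k)) \<le> (\<Sum>k<N. h k (u k)) + 1" if "(u, v) \<in> parcs (cart_pow G N)" for u v
  proof -
    obtain k where k: "k < N" "(u k, v k) \<in> parcs G" "\<forall>j<N. j \<noteq> k \<longrightarrow> u j = v j"
      using \<open>(u, v) \<in> parcs (cart_pow G N)\<close> by (auto simp: cart_pow_def)
    have "h k (v k) \<le> h k (u k) + 1"
      using h[OF k(1)] k(2) by (simp add: is_dist_from_def)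
    then show ?thesis using split[OF k(1)] rest[OF k(3)] by simp
  qed
  show "\<exists>u. (u, v) \<in> parcs (cart_pow G N) \<and> (\<Sum>k<N. h k (v k)) = (\<Sum>k<N. h k (u k)) + 1"
    if v: "v \<in> pverts (cart_pow G N)" "v \<noteq> x" for v
  proof -
    have vm: "v \<in> {..<N} \<rightarrow>\<^sub>E pverts G" and xm: "x \<in> {..<N} \<rightarrow>\<^sub>E pverts G"
      using v(1) assms(2) by (auto simp: cart_pow_def)
    \<comment> \<open>Tuples are extensional, so distinct ones differ at an index below
      \<open>N\<close>.\<close>
    then obtain k where k: "k < N" "v k \<noteq> x k"
      using v(2) by (metis PiE_ext lessThan_iff)
    then obtain a where a: "(a, v k) \<in> parcs G" "h k (v k) = h k a + 1"
      using h[OF k(1)] vm unfolding is_dist_from_def by (metis PiE_mem lessThan_iff)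
    define u where "u = v(k := a)"
    have "u \<in> {..<N} \<rightarrow>\<^sub>E pverts G"
      using vm k(1) a(1) wellformed' by (auto simp: u_def PiE_def extensional_def)
    then have "(u, v) \<in> parcs (cart_pow G N)"
      using vm k(1) a(1) by (auto simp: cart_pow_def u_def)
    moreover have "\<forall>j<N. j \<noteq> k \<longrightarrow> u j = v j" by (simp add: u_def)
    ultimately show ?thesis
      using split[OF k(1)] rest[of k u v] a(2) by (intro exI[of _ u]) (simp add: u_def)
  qed
qed

section \<open>Farthest vertices of a tree\<close>

text \<open>Removing loops turns \<open>p\<close> into a path that still misses \<open>y\<close>;
  the arcs from \<open>y\<close> to \<open>z1\<close> and from \<open>z2\<close> to \<open>y\<close>
  close it up without repeating a vertex.\<close>

lemma (in pair_graph) cycle_through_two_neighbours: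
  assumes z: "(y, z1) \<in> parcs G" "(y, z2) \<in> parcs G" "z1 \<noteq> z2"
    and p: "awalk z1 p z2" "y \<notin> set (pawalk_verts z1 p)"
  shows "\<exists>c. cycle c \<and> 3 \<le> length c"
proof -
  define q where "q = awalk_to_apath p"
  have q: "apath z1 q z2" and sub: "set q \<subseteq> set p"
    using apath_awalk_to_apath[OF p(1)] awalk_to_apath_subset[OF p(1)] by (auto simp: q_def)
  have wq: "awalk z1 q z2" using q by (rule awalkI_apath)
  have yq: "y \<notin> set (pawalk_verts z1 q)"
    using p(2) sub unfolding set_awalk_verts[OF p(1)] set_awalk_verts[OF wq] by auto
  \<comment> \<open>This arc, together with the two at \<open>y\<close>, gives length at least 3 and
    so rules out an arc followed by its reverse.\<close>
  have "q \<noteq> []" using z(3) wq by (auto simp: awalk_Nil_iff)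
  have z2y: "awalk z2 [(z2, y)] y"
    using arc_implies_awalk[OF arcs_symmetric[OF z(2)]] by simp
  have walk: "awalk y ((y, z1) # q @ [(z2, y)]) y"
    using z(1) awalk_appendI[OF wq z2y] by (simp add: awalk_Cons_iff del: awalk_append_iff)
  have "pawalk_verts z1 (q @ [(z2, y)]) = pawalk_verts z1 q @ [y]"
    using awalk_verts_append[OF awalk_appendI[OF wq z2y]] wq by (simp)
  then have "distinct (tl (pawalk_verts y ((y, z1) # q @ [(z2, y)])))"
    using q yq by (simp add: apath_def)
  then have "cycle ((y, z1) # q @ [(z2, y)])"
    using walk unfolding cycle_def by blast
  moreover have "3 \<le> length ((y, z1) # q @ [(z2, y)])"
    using \<open>q \<noteq> []\<close> by (cases q) auto
  ultimately show ?thesis by blast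
qed

text \<open>A shortest walk from \<open>z\<close> to \<open>x\<close> cannot pass through another vertex that is at least as far
  from \<open>x\<close> as \<open>z\<close>.\<close>
lemma (in pair_graph) walk_avoiding_far_vertex:
  assumes h: "is_dist_from G x h" and x: "x \<in> pverts G" "y \<noteq> x"
    and z: "z \<in> pverts G" "z \<noteq> y" "h z \<le> h y"
  shows "\<exists>p. awalk z p x \<and> y \<notin> set (pawalk_verts z p)"
  using z
proof (induction "h z" arbitrary: z rule: less_induct)
  case less
  show ?case
  proof (cases "z = x")
    case True
    then show ?thesis using x by (intro exI[of _ "[]"]) (auto simp: awalk_Nil_iff)
  next
    case False
    then obtain u where u: "(u, z) \<in> parcs G" "h z = h u + 1"
      using h less.prems unfolding is_dist_from_def by blast
    then have "u \<noteq> y" "u \<in> pverts G" using less.prems wellformed' by auto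
    then obtain p where "awalk u p x" "y \<notin> set (pawalk_verts u p)"
      using less.hyps[of u] less.prems u by auto
    then show ?thesis
      using u less.prems arcs_symmetric[OF u(1)]
      by (intro exI[of _ "(z, u) # p"]) (auto simp: awalk_Cons_iff)
  qed
qed

section \<open>Leaves, farthest vertices and vertices that are not leaves\<close>

lemma leavesI:
  assumes "(y, u) \<in> parcs G" "y \<in> pverts G" "\<And>z. (y, z) \<in> parcs G \<Longrightarrow> z = u"
  shows "y \<in> leaves G"
proof -
  have "out_arcs (with_proj G) y \<subseteq> {(y, u)}"
  proof
    fix e assume "e \<in> out_arcs (with_proj G) y"
    then show "e \<in> {(y, u)}"
      using assms(3)[of "snd e"] by (cases e) (simp add: out_arcs_def)
  qed
  moreover have "(y, u) \<in> out_arcs (with_proj G) y"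
    using assms(1) by (simp add: out_arcs_def)
  ultimately have "out_arcs (with_proj G) y = {(y, u)}" by blast
  then show ?thesis using assms(2) by (simp add: leaves_def out_degree_def)
qed

lemma not_leafI:
  assumes "(y, u) \<in> parcs G" "(y, v) \<in> parcs G" "u \<noteq> v"
  shows "y \<notin> leaves G"
proof
  assume "y \<in> leaves G"
  then obtain e where "out_arcs (with_proj G) y = {e}"
    by (auto simp: leaves_def out_degree_def card_1_singleton_iff)
  moreover have "(y, u) \<in> out_arcs (with_proj G) y" "(y, v) \<in> out_arcs (with_proj G) y"
    using assms by (auto simp: out_arcs_def)
  ultimately show False using assms(3) by auto
qed

text \<open>Two distinct neighbours of \<open>y\<close> would both reach \<open>x\<close> without
  meeting \<open>y\<close>, since neither is farther from \<open>x\<close>. One walk followed by the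
  reverse of the other joins them and yields a forbidden cycle.\<close>

lemma farthest_vertex_is_leaf:
  assumes "simple_tree T" "is_dist_from T x h" "x \<in> pverts T" "y \<in> pverts T" "y \<noteq> x"
    and far: "\<And>z. z \<in> pverts T \<Longrightarrow> h z \<le> h y"
  shows "y \<in> leaves T"
proof -
  interpret pair_graph T using assms(1) by (simp add: simple_tree_def)
  obtain u where "(u, y) \<in> parcs T"
    using assms(2,4,5) unfolding is_dist_from_def by blast
  then have yu: "(y, u) \<in> parcs T" by (rule arcs_symmetric)
  have "z = u" if yz: "(y, z) \<in> parcs T" for z
  proof (rule ccontr)
    assume "z \<noteq> u"
    have verts: "z \<in> pverts T" "u \<in> pverts T" "z \<noteq> y" "u \<noteq> y"
      using in_arcsD2[OF yz] in_arcsD2[OF yu] no_loops'[OF yz] no_loops'[OF yu] by auto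
    obtain p where p: "awalk z p x" "y \<notin> set (pawalk_verts z p)"
      using walk_avoiding_far_vertex[OF assms(2,3,5)] verts far by blast
    obtain q where q: "awalk u q x" "y \<notin> set (pawalk_verts u q)"
      using walk_avoiding_far_vertex[OF assms(2,3,5)] verts far by blast
    have q': "awalk x (rev_path q) u" "y \<notin> set (pawalk_verts x (rev_path q))"
      using q awalk_verts_rev_path[OF q(1)] by auto
    have pq: "awalk z (p @ rev_path q) u" using p(1) q'(1) by (rule awalk_appendI)
    have "y \<notin> set (pawalk_verts z (p @ rev_path q))"
      using p q' set_awalk_verts_append[OF p(1) q'(1)] by auto
    then have "\<exists>c. cycle c \<and> 3 \<le> length c"
      using cycle_through_two_neighbours[OF yz yu \<open>z \<noteq> u\<close> pq] by blast
    then show False using assms(1) by (simp add: simple_tree_def)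
  qed
  then show ?thesis using leavesI[OF yu assms(4)] by blast
qed

text \<open>For the tree this makes the leaves a proper subset of the vertices, hence the growth
  rate exceeds 1. Either some shortest path from \<open>x\<close> has an inner vertex, or
  \<open>x\<close> is adjacent to all the other vertices.\<close>

lemma connected_exists_nonleaf:
  assumes "pair_graph G" "Digraph_Component.connected (with_proj G)" "3 \<le> card (pverts G)"
  shows "\<exists>v \<in> pverts G. v \<notin> leaves G"
proof -
  interpret pair_graph G by fact
  obtain x where x: "x \<in> pverts G" using assms(3) by fastforce
  obtain h where h: "is_dist_from G x h"
    using connected_is_dist_from_exists[OF assms(1,2) x] ..
  have pred: "\<exists>u. (u, v) \<in> parcs G \<and> h v = h u + 1" if "v \<in> pverts G" "v \<noteq> x" for v
    using h that by (simp add: is_dist_from_def)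
  have hx: "h x = 0" using h by (simp add: is_dist_from_def)
  show ?thesis
  proof (cases "\<exists>v \<in> pverts G. 2 \<le> h v")
    case True
    then obtain v where v: "v \<in> pverts G" "2 \<le> h v" by auto
    then obtain u where u: "(u, v) \<in> parcs G" "h v = h u + 1"
      using pred[of v] hx by fastforce
    then obtain w where w: "(w, u) \<in> parcs G" "h u = h w + 1"
      using pred[of u] hx v wellformed' by fastforce
    \<comment> \<open>The distances of \<open>w\<close> and \<open>v\<close> from \<open>x\<close>
      differ by 2, so \<open>u\<close> has two distinct neighbours.\<close>
    have "w \<noteq> v" using u w by auto
    then have "u \<notin> leaves G" using not_leafI[OF u(1) arcs_symmetric[OF w(1)]] by simp
    then show ?thesis using in_arcsD1[OF u(1)] by auto
  next
    case False
    have adj: "(x, v) \<in> parcs G" if v: "v \<in> pverts G" "v \<noteq> x" for v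
    proof -
      obtain u where u: "(u, v) \<in> parcs G" "h v = h u + 1" using pred v by blast
      have "h v < 2" using False v by auto
      then have "h u = 0" using u by simp
      then have "u = x" using pred[of u] u(1) wellformed' by fastforce
      then show ?thesis using u by simp
    qed
    have "2 \<le> card (pverts G - {x})" using assms(3) x by simp
    then obtain S where "S \<subseteq> pverts G - {x}" "card S = 2"
      by (meson obtain_subset_with_card_n)
    then obtain a b where "a \<in> pverts G - {x}" "b \<in> pverts G - {x}" "a \<noteq> b"
      by (auto simp: card_2_iff)
    then have "x \<notin> leaves G" using adj by (intro not_leafI[of x a _ b]) auto
    then show ?thesis using x by auto
  qed
qed

section \<open>Spheres of largest radius in the power\<close>

lemma sphere_within_leaves:
  assumes "simple_tree T" "2 \<le> card (pverts T)" "x \<in> pverts (cart_pow T N)"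
  shows "\<exists>r. graph_sphere (cart_pow T N) r x \<noteq> {} \<and>
    graph_sphere (cart_pow T N) r x \<subseteq> {..<N} \<rightarrow>\<^sub>E leaves T"
proof -
  interpret pair_graph T using assms(1) by (simp add: simple_tree_def)
  interpret P: pair_graph "cart_pow T N" by (rule pair_graph_cart_pow) (rule pair_graph)
  let ?V = "pverts T"
  have fin: "finite ?V" by simp
  have xV: "x k \<in> ?V" if "k < N" for k
    using assms(3) that by (auto simp: cart_pow_def)
  have "\<exists>h. \<forall>a\<in>?V. is_dist_from T a (h a)"
    using connected_is_dist_from_exists[OF pair_graph] assms(1)
    by (intro bchoice) (auto simp: simple_tree_def)
  then obtain H where H: "\<And>a. a \<in> ?V \<Longrightarrow> is_dist_from T a (H a)" by blast
  have "\<exists>y\<in>?V. \<forall>z\<in>?V. H a z \<le> H a y" if "a \<in> ?V" for a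
  proof -
    have "H a ` ?V \<noteq> {}" using that by auto
    then have "Max (H a ` ?V) \<in> H a ` ?V" using fin by (intro Max_in) auto
    then obtain y where "y \<in> ?V" "H a y = Max (H a ` ?V)" by auto
    then show ?thesis using fin by (intro bexI[of _ y]) auto
  qed
  then have "\<exists>m. \<forall>a\<in>?V. m a \<in> ?V \<and> (\<forall>z\<in>?V. H a z \<le> H a (m a))"
    by (intro bchoice) blast
  then obtain m where m: "\<And>a. a \<in> ?V \<Longrightarrow> m a \<in> ?V" "\<And>a z. a \<in> ?V \<Longrightarrow> z \<in> ?V \<Longrightarrow> H a z \<le> H a (m a)"
    by blast
  have leaf: "y \<in> leaves T" if a: "a \<in> ?V" and y: "y \<in> ?V" "H a y = H a (m a)" for a y
  proof (rule farthest_vertex_is_leaf[OF assms(1) H[OF a] a y(1)])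
    show "H a z \<le> H a y" if "z \<in> ?V" for z using m(2)[OF a that] y(2) by simp
    show "y \<noteq> a"
    proof
      \<comment> \<open>If \<open>a\<close> were farthest from itself, \<open>H a\<close> would
        vanish on all vertices; but any other vertex has a predecessor and so a positive
        value.\<close>
      assume "y = a"
      have "?V \<noteq> {a}" using assms(2) by auto
      then obtain z where z: "z \<in> ?V" "z \<noteq> a" using a by auto
      have "H a a = 0" using H[OF a] by (simp add: is_dist_from_def)
      then have "H a z = 0" using m(2)[OF a z(1)] y(2) \<open>y = a\<close> by simp
      moreover obtain u where "H a z = H a u + 1"
        using H[OF a] z unfolding is_dist_from_def by blast
      ultimately show False by simp
    qed
  qed
  \<comment> \<open>The sum of the coordinatewise eccentricities, attained at the tuple of the
    farthest vertices \<open>m (x k)\<close>.\<close>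
  define r where "r = (\<Sum>k<N. H (x k) (m (x k)))"
  have sphere: "graph_sphere (cart_pow T N) r x =
      {y \<in> pverts (cart_pow T N). (\<Sum>k<N. H (x k) (y k)) = r}"
    using H xV by (intro graph_sphere_eq is_dist_from_cart_pow pair_wf_digraph P.pair_wf_digraph assms(3)) auto
  have "(\<lambda>k\<in>{..<N}. m (x k)) \<in> graph_sphere (cart_pow T N) r x"
    unfolding sphere using m xV by (auto simp: r_def cart_pow_def)
  moreover have "y \<in> {..<N} \<rightarrow>\<^sub>E leaves T" if "y \<in> graph_sphere (cart_pow T N) r x" for y
  proof -
    have yP: "y \<in> {..<N} \<rightarrow>\<^sub>E ?V" and sum: "(\<Sum>k<N. H (x k) (y k)) = (\<Sum>k<N. H (x k) (m (x k)))"
      using that unfolding sphere by (auto simp: r_def cart_pow_def)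
    have yV: "y k \<in> ?V" if "k < N" for k using yP that by auto
    \<comment> \<open>No summand exceeds its maximum and the sums agree, so every summand attains
      its maximum.\<close>
    have "H (x k) (y k) = H (x k) (m (x k))" if "k < N" for k
      using sum m(2) xV yV that by (intro sum_mono_inv[OF sum]) auto
    then have "y k \<in> leaves T" if "k < N" for k
      using leaf[OF xV yV] that by blast
    then show ?thesis using yP by (auto simp: PiE_def)
  qed
  ultimately show ?thesis by blast
qed

section \<open>Lower bounds for the maximal operator\<close>

text \<open>A crude bound uniform in \<open>r\<close>, by the triangle inequality. It supplies the
  boundedness that the supremum over radii requires.\<close>

lemma sphere_average_le:
  assumes "finite (pverts G)"
  shows "1 / real (card (graph_sphere G r x)) * cmod (\<Sum>y\<in>graph_sphere G r x. f y)
    \<le> (\<Sum>y\<in>pverts G. cmod (f y))"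
proof -
  have "cmod (\<Sum>y\<in>graph_sphere G r x. f y) \<le> (\<Sum>y\<in>graph_sphere G r x. cmod (f y))"
    by (rule norm_sum)
  also have "\<dots> \<le> (\<Sum>y\<in>pverts G. cmod (f y))"
    using assms by (intro sum_mono2) (auto simp: graph_sphere_def)
  finally have "cmod (\<Sum>y\<in>graph_sphere G r x. f y) \<le> (\<Sum>y\<in>pverts G. cmod (f y))" .
  \<comment> \<open>An empty sphere is covered because \<open>1 / 0 = 0\<close>.\<close>
  moreover have "1 / real (card (graph_sphere G r x)) \<le> 1"
    by (cases "card (graph_sphere G r x)") auto
  ultimately show ?thesis
    using mult_mono[of "1 / real (card (graph_sphere G r x))" 1] by fastforce
qed

lemma sphere_average_le_spherical_maximal:
  assumes "finite (pverts G)" "graph_sphere G r x \<noteq> {}"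
  shows "1 / real (card (graph_sphere G r x)) * cmod (\<Sum>y\<in>graph_sphere G r x. f y)
    \<le> spherical_maximal G f x"
  unfolding spherical_maximal_def
  using assms sphere_average_le[OF assms(1)]
  by (intro cSUP_upper bdd_aboveI2[where M = "\<Sum>y\<in>pverts G. cmod (f y)"]) auto

lemma spherical_maximal_bounds:
  assumes "pair_fin_digraph G" "x \<in> pverts G"
  shows "0 \<le> spherical_maximal G f x" "spherical_maximal G f x \<le> (\<Sum>y\<in>pverts G. cmod (f y))"
proof -
  interpret pair_fin_digraph G by fact
  have ne: "graph_sphere G 0 x \<noteq> {}"
    using self_in_graph_sphere_0[OF _ assms(2)] pair_wf_digraph_axioms by auto
  have "0 \<le> 1 / real (card (graph_sphere G 0 x)) * cmod (\<Sum>y\<in>graph_sphere G 0 x. f y)" by simp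
  also have "\<dots> \<le> spherical_maximal G f x"
    using ne pair_finite_verts by (intro sphere_average_le_spherical_maximal) auto
  finally show "0 \<le> spherical_maximal G f x" .
  show "spherical_maximal G f x \<le> (\<Sum>y\<in>pverts G. cmod (f y))"
    unfolding spherical_maximal_def
    using ne sphere_average_le[OF pair_finite_verts] by (intro cSUP_least) auto
qed

section \<open>Comparison of norms and the supremum over unit functions\<close>

lemma norm_le_lp_norm:
  assumes "finite V" "x \<in> V" "0 < p"
  shows "norm (f x) \<le> lp_norm V p f"
proof -
  have "norm (f x) powr p \<le> (\<Sum>x\<in>V. norm (f x) powr p)"
    using assms by (intro member_le_sum) auto
  then have "(norm (f x) powr p) powr (1 / p) \<le> lp_norm V p f"
    unfolding lp_norm_def using assms by (intro powr_mono2) auto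
  then show ?thesis using assms by (simp add: powr_powr)
qed

lemma lp_norm_mono:
  assumes "0 < p" "\<And>x. x \<in> V \<Longrightarrow> norm (f x) \<le> norm (g x)"
  shows "lp_norm V p f \<le> lp_norm V p g"
  unfolding lp_norm_def using assms by (intro powr_mono2 sum_mono sum_nonneg) auto

lemma lp_norm_le_maximal_op_norm:
  assumes "pair_fin_digraph G" "0 < p" "lp_norm (pverts G) p f = 1"
  shows "lp_norm (pverts G) p (spherical_maximal G f) \<le> maximal_op_norm G p"
proof -
  interpret pair_fin_digraph G by fact
  let ?V = "pverts G"
  have "lp_norm ?V p (spherical_maximal G g) \<le> lp_norm ?V p (\<lambda>_. real (card ?V))"
    if g: "lp_norm ?V p g = 1" for g
  proof (rule lp_norm_mono[OF assms(2)])
    fix x assume x: "x \<in> ?V"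
    \<comment> \<open>Unit norm forces every value to have modulus at most 1. The maximal function
      is then at most \<open>card ?V\<close> everywhere, which bounds the supremum over
      \<open>f\<close>.\<close>
    have "(\<Sum>y\<in>?V. cmod (g y)) \<le> (\<Sum>y\<in>?V. 1)"
      using norm_le_lp_norm[OF pair_finite_verts _ assms(2), of _ g] g by (intro sum_mono) auto
    then show "norm (spherical_maximal G g x) \<le> norm (real (card ?V))"
      using spherical_maximal_bounds[OF assms(1) x, of g] by simp
  qed
  then show ?thesis
    unfolding maximal_op_norm_def using assms(3)
    by (intro cSUP_upper bdd_aboveI2[where M = "lp_norm ?V p (\<lambda>_. real (card ?V))"]) auto
qed

text \<open>The indicator of \<open>L\<close>, scaled to unit norm, averages to its constant value
  over some sphere around each vertex. Its maximal function therefore dominates that constant on all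
  of \<open>pverts G\<close>.\<close>

lemma maximal_op_norm_ge_of_spheres_within:
  assumes G: "pair_fin_digraph G" "pverts G \<noteq> {}" and "0 < p" and L: "L \<subseteq> pverts G"
    and spheres: "\<And>x. x \<in> pverts G \<Longrightarrow> \<exists>r. graph_sphere G r x \<noteq> {} \<and> graph_sphere G r x \<subseteq> L"
  shows "(real (card (pverts G)) / real (card L)) powr (1 / p) \<le> maximal_op_norm G p"
proof -
  interpret pair_fin_digraph G by fact
  let ?V = "pverts G"
  have finL: "finite L" using L pair_finite_verts finite_subset by blast
  have "L \<noteq> {}" using spheres G(2) by blast
  then have cL: "0 < card L" using finL by (simp add: card_gt_0_iff)
  \<comment> \<open>Chosen so that \<open>card L * a powr p = 1\<close>.\<close>
  define a where "a = real (card L) powr (- (1 / p))"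
  have "a powr p = real (card L) powr (-1)"
    using assms(3) by (simp only: a_def powr_powr) simp
  then have ap: "a powr p = 1 / real (card L)"
    using cL by (simp add: powr_minus_divide)
  have a0: "0 \<le> a" by (simp add: a_def)
  define f where "f = (\<lambda>x. if x \<in> L then complex_of_real a else 0)"
  have "(\<Sum>x\<in>?V. cmod (f x) powr p) = (\<Sum>x\<in>L. a powr p)"
    using L pair_finite_verts a0 assms(3) by (intro sum.mono_neutral_cong_right) (auto simp: f_def)
  then have f1: "lp_norm ?V p f = 1"
    using ap cL by (simp add: lp_norm_def)
  have Mf: "a \<le> spherical_maximal G f x" if x: "x \<in> ?V" for x
  proof -
    obtain r where r: "graph_sphere G r x \<noteq> {}" "graph_sphere G r x \<subseteq> L" using spheres[OF x] by auto
    have "finite (graph_sphere G r x)" using r(2) finL finite_subset by blast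
    then have "0 < card (graph_sphere G r x)" using r(1) by (simp add: card_gt_0_iff)
    moreover have "(\<Sum>y\<in>graph_sphere G r x. f y) = (\<Sum>y\<in>graph_sphere G r x. complex_of_real a)"
      using r(2) by (intro sum.cong) (auto simp: f_def)
    ultimately have "1 / real (card (graph_sphere G r x)) * cmod (\<Sum>y\<in>graph_sphere G r x. f y) = a"
      using a0 by (simp add: norm_mult)
    then show ?thesis
      using sphere_average_le_spherical_maximal[OF pair_finite_verts r(1), of f] by simp
  qed
  have "(real (card ?V) / real (card L)) powr (1 / p) = lp_norm ?V p (\<lambda>_. a)"
    using ap a0 by (simp add: lp_norm_def)
  also have "\<dots> \<le> lp_norm ?V p (spherical_maximal G f)"
    using Mf a0 by (intro lp_norm_mono[OF assms(3)]) fastforce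
  also have "\<dots> \<le> maximal_op_norm G p"
    by (rule lp_norm_le_maximal_op_norm[OF G(1) assms(3) f1])
  finally show ?thesis .
qed

section \<open>The exponential lower bound\<close>

theorem theorem1p5:
  fixes T :: "'a pair_pre_digraph"
  assumes "simple_tree T"
    and "card (pverts T) \<ge> 3"
  shows "(\<forall>p::real. \<forall>N::nat. 1 \<le> p \<longrightarrow> 1 \<le> N \<longrightarrow>
            maximal_op_norm (cart_pow T N) p powr p
              \<ge> (real (card (pverts T)) / real (card (leaves T))) ^ N) \<and>
         (\<forall>p::real. 1 \<le> p \<longrightarrow>
            (\<exists>c::real. c > 1 \<and> (\<forall>N::nat. 1 \<le> N \<longrightarrow> maximal_op_norm (cart_pow T N) p \<ge> c ^ N)))"
proof -
  interpret pair_graph T using assms(1) by (simp add: simple_tree_def)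
  define q where "q = real (card (pverts T)) / real (card (leaves T))"
  have ne: "pverts T \<noteq> {}" using assms(2) by auto
  have sub: "leaves T \<subseteq> pverts T" by (auto simp: leaves_def)
  have card_pow: "card ({..<N} \<rightarrow>\<^sub>E A) = card A ^ N" for N :: nat and A :: "'a set"
    by (simp add: card_PiE)
  \<comment> \<open>Both claims follow from this root form: raise it to the power \<open>p\<close>,
    or exchange the root with the \<open>N\<close>-th power.\<close>
  have bound: "(q ^ N) powr (1 / p) \<le> maximal_op_norm (cart_pow T N) p" if "1 \<le> p" for p N
  proof -
    interpret P: pair_graph "cart_pow T N" by (rule pair_graph_cart_pow) (rule pair_graph)
    have verts: "pverts (cart_pow T N) = {..<N} \<rightarrow>\<^sub>E pverts T" by (simp add: cart_pow_def)
    have "(real (card (pverts (cart_pow T N))) / real (card ({..<N} \<rightarrow>\<^sub>E leaves T))) powr (1 / p)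
        \<le> maximal_op_norm (cart_pow T N) p"
    proof (rule maximal_op_norm_ge_of_spheres_within)
      show "pair_fin_digraph (cart_pow T N)" ..
      show "pverts (cart_pow T N) \<noteq> {}" using ne by (auto simp: verts PiE_eq_empty_iff)
      show "0 < p" using that by simp
      show "{..<N} \<rightarrow>\<^sub>E leaves T \<subseteq> pverts (cart_pow T N)"
        unfolding verts by (intro PiE_mono sub)
    qed (use sphere_within_leaves[OF assms(1)] assms(2) in auto)
    then show ?thesis by (simp add: verts card_pow q_def power_divide)
  qed
  \<comment> \<open>Read off from a nonempty sphere in the first power. Without a leaf,
    \<open>q\<close> would be 0 by the convention for division.\<close>
  have "leaves T \<noteq> {}"
  proof -
    obtain x where "x \<in> pverts T" using ne by auto
    then have "(\<lambda>k\<in>{..<1}. x) \<in> pverts (cart_pow T 1)" by (auto simp: cart_pow_def)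
    then obtain y where "y \<in> {..<1::nat} \<rightarrow>\<^sub>E leaves T"
      using sphere_within_leaves[OF assms(1)] assms(2) by fastforce
    then show ?thesis by auto
  qed
  moreover have fin: "finite (pverts T)" by simp
  moreover have "leaves T \<subset> pverts T"
    using connected_exists_nonleaf[OF pair_graph _ assms(2)] assms(1) sub
    by (auto simp: simple_tree_def)
  ultimately have "0 < card (leaves T)" "card (leaves T) < card (pverts T)"
    using sub by (auto simp: card_gt_0_iff psubset_card_mono intro: finite_subset)
  then have q: "1 < q" by (simp add: q_def)
  show ?thesis
  proof (intro conjI allI impI)
    fix p :: real and N :: nat
    assume "1 \<le> p"
    then have "((q ^ N) powr (1 / p)) powr p \<le> maximal_op_norm (cart_pow T N) p powr p"
      using bound by (intro powr_mono2) auto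
    then show "(real (card (pverts T)) / real (card (leaves T))) ^ N \<le>
        maximal_op_norm (cart_pow T N) p powr p"
      using \<open>1 \<le> p\<close> q by (simp add: powr_powr flip: q_def)
  next
    fix p :: real
    assume p: "1 \<le> p"
    \<comment> \<open>The growth constant is \<open>q powr (1 / p)\<close>, which exceeds 1 because
      \<open>q\<close> does.\<close>
    have "(q powr (1 / p)) ^ N = (q ^ N) powr (1 / p)" for N
      using q by (simp add: powr_powr mult.commute flip: powr_realpow)
    then show "\<exists>c>1. \<forall>N\<ge>1. c ^ N \<le> maximal_op_norm (cart_pow T N) p"
      using bound[OF p] q p by (intro exI[of _ "q powr (1 / p)"]) (auto intro: gr_one_powr)
  qed
qed

end
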